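(* Let $n\ge 1$, $\mu>0$, and consider the dynamical system $\dot z=F(z)$ on the polydisc $\mathbb{D}^n(\mu)\subset\mathbb{C}^n$ with analytic vector field $F=(F_1,\dots,F_n)$, $$\dot z_l=F_l(z)=\sum_{k=1}^\infty a_{l,k}\,z^{\alpha(k)},\qquad l=1,\dots,n,\quad a_{l,k}\in\mathbb{C}.$$ Assume that: (1) the components $F_l$ are holomorphic on the closed polydisc $\overline{\mathbb{D}^n(\mu)}$, belong to the Hardy space $\mathbb{H}^2(\mathbb{D}^n(\mu))$, and $F$ generates a flow $\varphi^t$ ($t\ge 0$) that is holomorphic on $\mathbb{D}^n(\mu)$ and maps $\mathbb{D}^n(\mu)$ to itself; (2) $0$ is the unique equilibrium of $F$ in $\mathbb{D}^n(\mu)$, it is hyperbolic, and all eigenvalues $\tilde\lambda_j$ of the Jacobian matrix $JF(0)$ satisfy $\Re(\tilde\lambda_j)<0$; (3) the Jacobian matrix $JF(0)$ is diagonal; (4) the series $$L_\mu=\sum_{l=1}^n\sum_{k=1}^\infty \mu^{|\alpha(k)|}\,|a_{l,k}|$$ is convergent. Let $R=\min_{l=1,\dots,n}|\Re(a_{l,l})|$ and let $\rho>0$ satisfy $$\rho<\frac{\mu R}{L_\mu}.$$ If $\mathbb{D}^n(\rho)\subset\mathbb{D}^n(\mu)$ is forward invariant with respect to the flow $\varphi^t$, then the system $\dot z=F(z)$ is globally asymptotically stable (GAS) on $\mathbb{D}^n(\rho)$.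
   Context: For $\rho>0$, $\mathbb{D}^n(\rho)=\{z\in\mathbb{C}^n: |z_1|<\rho,\dots,|z_n|<\rho\}$, with distinguished boundary $(\partial\mathbb{D}(\rho))^n$. For a multi-index $\alpha=(\alpha_1,\dots,\alpha_n)\in\mathbb{N}^n$ (with $0\in\mathbb{N}$), $|\alpha|=\alpha_1+\cdots+\alpha_n$ and $z^\alpha=z_1^{\alpha_1}\cdots z_n^{\alpha_n}$. The map $k\mapsto\alpha(k)$, $k\in\mathbb{N}=\{0,1,2,\dots\}$, enumerates $\mathbb{N}^n$ in the following (graded lexicographic) order: $\alpha(k_1)$ comes before $\alpha(k_2)$ if $|\alpha(k_1)|<|\alpha(k_2)|$, or if $|\alpha(k_1)|=|\alpha(k_2)|$ and $\alpha_j(k_1)>\alpha_j(k_2)$ for the smallest $j$ with $\alpha_j(k_1)\ne\alpha_j(k_2)$. Thus $\alpha(0)=0$ and, for $1\le l\le n$, $z^{\alpha(l)}=z_l$, so $a_{l,l}$ is the coefficient of $z_l$ in $F_l$, i.e. the $l$-th diagonal entry of $JF(0)$. The series for $F_l$ is its Taylor expansion at $0$; $\Re$ denotes the real part. The Hardy space $\mathbb{H}^2(\mathbb{D}^n(\mu))$ is the space of holomorphic $f:\mathbb{D}^n(\mu)\to\mathbb{C}$ with $\|f\|^2=\lim_{r\to1^-}\int_{(\partial\mathbb{D}(\mu))^n}|f(r\omega)|^2\,dm_n(\omega)<\infty$, where $m_n$ is the normalized Lebesgue measure on $(\partial\mathbb{D}(\mu))^n$. $\mathbb{D}^n(\rho)$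 is forward invariant if $\varphi^t(\mathbb{D}^n(\rho))\subset\mathbb{D}^n(\rho)$ for all $t\ge0$. The system is GAS on $\mathbb{D}^n(\rho)$ if the equilibrium $0$ is Lyapunov stable and $\varphi^t(z)\to0$ as $t\to+\infty$ for every $z\in\mathbb{D}^n(\rho)$. *)

theory Defs
  imports "HOL-Analysis.Analysis"
begin

text \<open>Points of \<open>\<complex>\<^sup>n\<close> are elements of \<^typ>\<open>complex ^ 'n\<close>. Where the order of the coordinates
  matters, the finite index type is linearly ordered and so plays the role of \<open>{1, \<dots>, n}\<close>.\<close>

definition polydisc :: "real \<Rightarrow> (complex ^ 'n) set" where
  "polydisc \<rho> = {z. \<forall>i. cmod (z $ i) < \<rho>}"

definition closed_polydisc :: "real \<Rightarrow> (complex ^ 'n) set" where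
  "closed_polydisc \<rho> = {z. \<forall>i. cmod (z $ i) \<le> \<rho>}"

text \<open>Holomorphy in several variables: \<open>\<complex>\<close>-linear Frechet differentiability on an open
  neighbourhood of \<open>S\<close>. For open \<open>S\<close> this is complex differentiability at every point of \<open>S\<close>;
  for closed \<open>S\<close> it is holomorphy across the boundary.\<close>

definition mv_holomorphic_on :: "(complex ^ 'n \<Rightarrow> complex) \<Rightarrow> (complex ^ 'n) set \<Rightarrow> bool" where
  "mv_holomorphic_on f S \<longleftrightarrow>
     (\<exists>U. open U \<and> S \<subseteq> U \<and>
       (\<forall>z\<in>U. \<exists>D. (f has_derivative D) (at z) \<and> (\<forall>c v. D (c *s v) = c * D v)))"


subsection \<open>Multi-indices\<close>

definition mi_size :: "('n::finite \<Rightarrow> nat) \<Rightarrow> nat" where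
  "mi_size \<alpha> = (\<Sum>i\<in>UNIV. \<alpha> i)"

definition mi_monom :: "complex ^ 'n \<Rightarrow> ('n \<Rightarrow> nat) \<Rightarrow> complex" where
  "mi_monom z \<alpha> = (\<Prod>i\<in>UNIV. (z $ i) ^ \<alpha> i)"

definition mi_before :: "('n::{finite,linorder} \<Rightarrow> nat) \<Rightarrow> ('n \<Rightarrow> nat) \<Rightarrow> bool" where
  "mi_before \<alpha> \<beta> \<longleftrightarrow>
     mi_size \<alpha> < mi_size \<beta> \<or>
     mi_size \<alpha> = mi_size \<beta> \<and> (\<exists>j. (\<forall>i<j. \<alpha> i = \<beta> i) \<and> \<alpha> j > \<beta> j)"

text \<open>The order-preserving enumeration of all multi-indices; it exists and is unique by
  \<open>mi_enum_ex1\<close> below.\<close>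

definition mi_enum :: "nat \<Rightarrow> ('n::{finite,linorder} \<Rightarrow> nat)" where
  "mi_enum = (THE e. bij e \<and> (\<forall>k1 k2. k1 < k2 \<longleftrightarrow> mi_before (e k1) (e k2)))"

text \<open>The position of a coordinate in \<open>{1, \<dots>, n}\<close>. By \<open>mi_enum_coord_pos\<close> below,
  \<^term>\<open>mi_enum (coord_pos l)\<close> is the exponent of the monomial \<open>z\<^sub>l\<close>.\<close>

definition coord_pos :: "'n::{finite,linorder} \<Rightarrow> nat" where
  "coord_pos l = card {j. j \<le> l}"

lemma mi_before_irrefl: "\<not> mi_before \<alpha> \<alpha>"
  by (simp add: mi_before_def)

lemma mi_before_trans:
  assumes "mi_before \<alpha> \<beta>" "mi_before \<beta> \<gamma>"
  shows "mi_before \<alpha> \<gamma>"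
proof (cases "mi_size \<alpha> = mi_size \<beta> \<and> mi_size \<beta> = mi_size \<gamma>")
  case True
  then obtain j k where j: "\<forall>i<j. \<alpha> i = \<beta> i" "\<alpha> j > \<beta> j"
    and k: "\<forall>i<k. \<beta> i = \<gamma> i" "\<beta> k > \<gamma> k"
    using assms by (auto simp: mi_before_def)
  have "(\<forall>i<min j k. \<alpha> i = \<gamma> i) \<and> \<alpha> (min j k) > \<gamma> (min j k)"
    using j k by (cases j k rule: linorder_cases) (auto simp: min_def)
  then show ?thesis using True unfolding mi_before_def by metis
next
  case False
  then show ?thesis using assms by (auto simp: mi_before_def)
qed

lemma mi_before_total:
  fixes \<alpha> \<beta> :: "'n::{finite,linorder} \<Rightarrow> nat"
  assumes "\<alpha> \<noteq> \<beta>"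
  shows "mi_before \<alpha> \<beta> \<or> mi_before \<beta> \<alpha>"
proof -
  let ?D = "{i. \<alpha> i \<noteq> \<beta> i}"
  have D: "finite ?D" "?D \<noteq> {}" using assms by auto
  define j where "j = Min ?D"
  have j: "\<alpha> j \<noteq> \<beta> j" using Min_in[OF D] by (simp add: j_def)
  have "\<alpha> i = \<beta> i" if "i < j" for i
    using that Min_le[OF D(1), of i] unfolding j_def by (metis (mono_tags) leD mem_Collect_eq)
  then show ?thesis using j unfolding mi_before_def by (metis linorder_neqE_nat)
qed

lemma finite_mi_before: "finite {\<gamma>. mi_before \<gamma> (\<beta> :: 'n::{finite,linorder} \<Rightarrow> nat)}"
proof (rule finite_subset)
  show "{\<gamma>. mi_before \<gamma> \<beta>} \<subseteq> {\<gamma>. \<forall>i. \<gamma> i \<in> {..mi_size \<beta>}}"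
  proof safe
    fix \<gamma> i assume "mi_before \<gamma> \<beta>"
    then have "mi_size \<gamma> \<le> mi_size \<beta>" by (auto simp: mi_before_def)
    moreover have "\<gamma> i \<le> mi_size \<gamma>" unfolding mi_size_def by (rule member_le_sum) auto
    ultimately show "\<gamma> i \<le> mi_size \<beta>" by simp
  qed
  have "finite (PiE (UNIV::'n set) (\<lambda>_. {..mi_size \<beta>}))" by (rule finite_PiE) auto
  then show "finite {\<gamma>::'n \<Rightarrow> nat. \<forall>i. \<gamma> i \<in> {..mi_size \<beta>}}"
    by (simp add: PiE_UNIV_domain Pi_def)
qed

definition mi_rank :: "('n::{finite,linorder} \<Rightarrow> nat) \<Rightarrow> nat" where
  "mi_rank \<beta> = card {\<gamma>. mi_before \<gamma> \<beta>}"

lemma mi_rank_less: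
  assumes "mi_before \<alpha> \<beta>"
  shows "mi_rank \<alpha> < mi_rank \<beta>"
  unfolding mi_rank_def
proof (rule psubset_card_mono[OF finite_mi_before])
  show "{\<gamma>. mi_before \<gamma> \<alpha>} \<subset> {\<gamma>. mi_before \<gamma> \<beta>}"
    using assms mi_before_trans mi_before_irrefl by blast
qed

lemma mi_rank_less_iff: "mi_rank \<alpha> < mi_rank \<beta> \<longleftrightarrow> mi_before \<alpha> \<beta>"
  by (metis mi_rank_less mi_before_total less_asym' less_irrefl)

lemma bij_mi_rank: "bij (mi_rank :: ('n::{finite,linorder} \<Rightarrow> nat) \<Rightarrow> nat)"
proof -
  let ?r = "mi_rank :: ('n \<Rightarrow> nat) \<Rightarrow> nat"
  have inj: "inj ?r"
    by (metis injI mi_rank_less mi_before_total less_irrefl)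
  have down: "{..<?r \<beta>} \<subseteq> range ?r" for \<beta>
  proof -
    let ?S = "{\<gamma>. mi_before \<gamma> \<beta>}"
    have "?r ` ?S = {..<?r \<beta>}"
    proof (rule card_subset_eq)
      show "?r ` ?S \<subseteq> {..<?r \<beta>}" using mi_rank_less by auto
      show "card (?r ` ?S) = card {..<?r \<beta>}"
        using inj by (simp add: card_image inj_on_subset) (simp add: mi_rank_def)
    qed simp
    then show ?thesis by blast
  qed
  have inf: "infinite (UNIV :: ('n \<Rightarrow> nat) set)"
  proof
    assume "finite (UNIV :: ('n \<Rightarrow> nat) set)"
    then have "finite (range (\<lambda>m::nat. (\<lambda>_::'n. m)))" by (rule finite_subset[rotated]) simp
    moreover have "inj (\<lambda>m::nat. (\<lambda>_::'n. m))" by (auto simp: inj_def fun_eq_iff)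
    ultimately show False using finite_imageD by blast
  qed
  then have "infinite (range ?r)" using inj finite_imageD by blast
  have "m \<in> range ?r" for m
  proof -
    obtain \<beta> where "m < ?r \<beta>"
      using \<open>infinite (range ?r)\<close> by (metis infinite_nat_iff_unbounded rangeE)
    then show ?thesis using down by blast
  qed
  then show ?thesis using inj by (auto simp: bij_def)
qed

lemma mi_enum_ex1:
  "\<exists>!e :: nat \<Rightarrow> 'n::{finite,linorder} \<Rightarrow> nat.
     bij e \<and> (\<forall>k1 k2. k1 < k2 \<longleftrightarrow> mi_before (e k1) (e k2))"
proof (rule ex1I[where a = "inv (mi_rank :: ('n \<Rightarrow> nat) \<Rightarrow> nat)"], goal_cases)
  case 1
  let ?e = "inv mi_rank :: nat \<Rightarrow> 'n \<Rightarrow> nat"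
  have "bij ?e" by (rule bij_imp_bij_inv[OF bij_mi_rank])
  moreover have "mi_rank (?e k) = k" for k by (rule surj_f_inv_f[OF bij_is_surj[OF bij_mi_rank]])
  ultimately show ?case by (simp add: mi_rank_less_iff[symmetric])
next
  case e: (2 e)
  have "mi_rank (e k) = k" for k
  proof -
    have "{\<gamma>. mi_before \<gamma> (e k)} = e ` {..<k}"
      using e by (auto simp: image_iff) (metis bij_pointE lessThan_iff)
    moreover have "inj_on e {..<k}" using e bij_is_inj inj_on_subset by blast
    ultimately show ?thesis by (simp add: mi_rank_def card_image)
  qed
  then show ?case
    using bij_mi_rank by (metis bij_is_inj inv_f_f ext)
qed

lemma mi_enum_bij: "bij mi_enum"
  and mi_enum_less_iff: "mi_before (mi_enum k1) (mi_enum k2) \<longleftrightarrow> k1 < k2"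
  using theI'[OF mi_enum_ex1] unfolding mi_enum_def by blast+

lemma mi_rank_enum: "mi_rank (mi_enum k :: 'n::{finite,linorder} \<Rightarrow> nat) = k"
proof -
  let ?e = "mi_enum :: nat \<Rightarrow> 'n \<Rightarrow> nat"
  have "{\<gamma>. mi_before \<gamma> (?e k)} = ?e ` {..<k}"
  proof (intro equalityI subsetI)
    fix \<gamma> assume "\<gamma> \<in> {\<gamma>. mi_before \<gamma> (?e k)}"
    moreover obtain m where "\<gamma> = ?e m" using mi_enum_bij by (metis bij_pointE)
    ultimately show "\<gamma> \<in> ?e ` {..<k}" using mi_enum_less_iff by auto
  next
    fix \<gamma> assume "\<gamma> \<in> ?e ` {..<k}"
    then show "\<gamma> \<in> {\<gamma>. mi_before \<gamma> (?e k)}" using mi_enum_less_iff by auto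
  qed
  moreover have "inj_on ?e {..<k}"
    using bij_is_inj[OF mi_enum_bij] by (rule inj_on_subset) simp
  ultimately show ?thesis by (simp add: mi_rank_def card_image)
qed

lemma mi_enum_rank: "mi_enum (mi_rank \<beta>) = \<beta>"
  using mi_enum_bij mi_rank_enum by (metis bij_pointE)

lemma mi_enum_0: "mi_enum 0 = (\<lambda>_::'n::{finite,linorder}. 0)"
proof -
  have "{\<gamma>. mi_before \<gamma> (\<lambda>_::'n. 0)} = {}" by (auto simp: mi_before_def mi_size_def)
  then have "mi_rank (\<lambda>_::'n. 0) = 0" by (simp add: mi_rank_def)
  then show ?thesis using mi_enum_rank by metis
qed

lemma mi_enum_coord_pos:
  fixes l :: "'n::{finite,linorder}"
  shows "mi_enum (coord_pos l) = (\<lambda>i. if i = l then 1 else 0)"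
proof -
  define u :: "'n \<Rightarrow> 'n \<Rightarrow> nat" where "u = (\<lambda>l i. if i = l then 1 else 0)"
  have size_u: "mi_size (u j) = 1" for j by (simp add: mi_size_def u_def)
  have inj: "inj u" by (rule injI) (metis u_def zero_neq_one)
  have "{\<gamma>. mi_before \<gamma> (u l)} = insert (\<lambda>_. 0) (u ` {j. j < l})"
  proof (intro equalityI subsetI)
    fix \<gamma> assume "\<gamma> \<in> {\<gamma>. mi_before \<gamma> (u l)}"
    then consider "mi_size \<gamma> = 0"
      | j where "mi_size \<gamma> = 1" "\<forall>i<j. \<gamma> i = u l i" "\<gamma> j > u l j"
      by (auto simp: mi_before_def size_u)
    then show "\<gamma> \<in> insert (\<lambda>_. 0) (u ` {j. j < l})"
    proof cases
      case 1
      then show ?thesis by (auto simp: mi_size_def fun_eq_iff)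
    next
      case 2
      have split: "mi_size \<gamma> = \<gamma> k + sum \<gamma> (UNIV - {k})" for k
        by (simp add: mi_size_def sum.remove[of UNIV k])
      have "\<gamma> j = 1" and rest: "sum \<gamma> (UNIV - {j}) = 0" using split[of j] 2 by linarith+
      from rest have "\<gamma> i = 0" if "i \<noteq> j" for i using that by simp
      then have \<gamma>: "\<gamma> = u j" using \<open>\<gamma> j = 1\<close> by (auto simp: u_def fun_eq_iff)
      have "j \<noteq> l" using \<open>\<gamma> j = 1\<close> 2 by (auto simp: u_def)
      moreover have "\<not> l < j" using 2(2) \<gamma> by (metis u_def less_irrefl one_neq_zero)
      ultimately show ?thesis using \<gamma> by auto
    qed
  next
    fix \<gamma> assume "\<gamma> \<in> insert (\<lambda>_. 0) (u ` {j. j < l})"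
    then show "\<gamma> \<in> {\<gamma>. mi_before \<gamma> (u l)}"
    proof
      assume "\<gamma> = (\<lambda>_. 0)"
      then show ?thesis by (simp add: mi_before_def size_u) (simp add: mi_size_def)
    next
      assume "\<gamma> \<in> u ` {j. j < l}"
      then obtain j where "j < l" "\<gamma> = u j" by auto
      then show ?thesis by (auto simp: mi_before_def size_u) (auto simp: u_def intro!: exI[of _ j])
    qed
  qed
  moreover have "(\<lambda>_. 0) \<notin> u ` {j. j < l}"
    by (metis (mono_tags, lifting) imageE u_def zero_neq_one)
  moreover have "{j. j \<le> l} = insert l {j. j < l}" by auto
  ultimately have "mi_rank (u l) = coord_pos l"
    using inj by (simp add: mi_rank_def coord_pos_def card_image inj_on_subset)
  then have "mi_enum (coord_pos l) = u l" using mi_enum_rank by metis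
  then show ?thesis by (simp add: u_def)
qed


subsection \<open>Hardy space\<close>

text \<open>Normalized Lebesgue measure on the distinguished boundary \<open>(\<partial>D(\<mu>))\<^sup>n\<close>, as the image of the
  uniform probability measure on \<open>[0, 2\<pi>]\<^sup>n\<close> under the standard parametrization.\<close>

definition torus_measure :: "real \<Rightarrow> (complex ^ 'n) measure" where
  "torus_measure \<mu> =
     distr (uniform_measure lborel (cbox 0 (\<chi> i. 2 * pi) :: (real ^ 'n) set)) borel
       (\<lambda>\<theta>. \<chi> i. of_real \<mu> * cis (\<theta> $ i))"

text \<open>The integral means are nondecreasing in \<open>r\<close>, so the limit is finite iff it exists in \<open>\<real>\<close>.\<close>

definition hardy_space :: "real \<Rightarrow> (complex ^ 'n \<Rightarrow> complex) set" where
  "hardy_space \<mu> = {f. mv_holomorphic_on f (polydisc \<mu>) \<and>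
     (\<exists>c::real. ((\<lambda>r. \<integral>\<omega>. (cmod (f (r *\<^sub>R \<omega>)))\<^sup>2 \<partial>torus_measure \<mu>) \<longlongrightarrow> c) (at_left 1))}"


subsection \<open>Dynamics\<close>

text \<open>Forward-time flow of \<open>dz/dt = F(z)\<close> on \<open>D\<close>; only the values \<open>\<phi> t z\<close> with \<open>t \<ge> 0\<close> and
  \<open>z \<in> D\<close> matter.\<close>

definition generates_flow ::
  "(complex ^ 'n \<Rightarrow> complex ^ 'n) \<Rightarrow> (complex ^ 'n) set \<Rightarrow> (real \<Rightarrow> complex ^ 'n \<Rightarrow> complex ^ 'n) \<Rightarrow> bool"
where
  "generates_flow F D \<phi> \<longleftrightarrow>
     (\<forall>z\<in>D. \<phi> 0 z = z \<and>
       (\<forall>t\<ge>0. \<phi> t z \<in> D \<and> ((\<lambda>s. \<phi> s z) has_vector_derivative F (\<phi> t z)) (at t within {0..})) \<and>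
       (\<forall>s\<ge>0. \<forall>t\<ge>0. \<phi> (s + t) z = \<phi> s (\<phi> t z)))"

definition forward_invariant ::
  "(real \<Rightarrow> complex ^ 'n \<Rightarrow> complex ^ 'n) \<Rightarrow> (complex ^ 'n) set \<Rightarrow> bool" where
  "forward_invariant \<phi> D \<longleftrightarrow> (\<forall>t\<ge>0. \<phi> t ` D \<subseteq> D)"

definition lyapunov_stable_on ::
  "(real \<Rightarrow> complex ^ 'n \<Rightarrow> complex ^ 'n) \<Rightarrow> (complex ^ 'n) set \<Rightarrow> bool" where
  "lyapunov_stable_on \<phi> D \<longleftrightarrow>
     (\<forall>\<epsilon>>0. \<exists>\<delta>>0. \<forall>z\<in>D. norm z < \<delta> \<longrightarrow> (\<forall>t\<ge>0. norm (\<phi> t z) < \<epsilon>))"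

definition GAS_on ::
  "(real \<Rightarrow> complex ^ 'n \<Rightarrow> complex ^ 'n) \<Rightarrow> (complex ^ 'n) set \<Rightarrow> bool" where
  "GAS_on \<phi> D \<longleftrightarrow> lyapunov_stable_on \<phi> D \<and> (\<forall>z\<in>D. ((\<lambda>t. \<phi> t z) \<longlongrightarrow> 0) at_top)"

definition eigenvalue :: "complex ^ 'n ^ 'n \<Rightarrow> complex \<Rightarrow> bool" where
  "eigenvalue A \<nu> \<longleftrightarrow> (\<exists>v. v \<noteq> 0 \<and> A *v v = \<nu> *s v)"

text \<open>For holomorphic \<open>F\<close> the Frechet derivative is \<open>\<complex>\<close>-linear, so \<^const>\<open>jacobian\<close> is the complex
  Jacobian matrix of the partial derivatives \<open>\<partial>F\<^sub>i/\<partial>z\<^sub>j\<close>.\<close>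

definition hyperbolic_at :: "(complex ^ 'n \<Rightarrow> complex ^ 'n) \<Rightarrow> complex ^ 'n \<Rightarrow> bool" where
  "hyperbolic_at F p \<longleftrightarrow> (\<forall>\<nu>. eigenvalue (jacobian F (at p)) \<nu> \<longrightarrow> Re \<nu> \<noteq> 0)"

definition diagonal_matrix :: "complex ^ 'n ^ 'n \<Rightarrow> bool" where
  "diagonal_matrix A \<longleftrightarrow> (\<forall>i j. i \<noteq> j \<longrightarrow> A $ i $ j = 0)"

end

theory Submission
  imports Defs "HOL-Complex_Analysis.Cauchy_Integral_Formula"
begin

text \<open>Near \<open>0\<close> the squared Euclidean norm is a strict Lyapunov function, because \<open>JF(0)\<close> is diagonal
  with entries of negative real part; hence orbits starting close to \<open>0\<close> decay exponentially, at a
  uniform rate. For an arbitrary \<open>z\<close> in the polydisc \<open>\<D>\<^sup>n(\<mu>)\<close> the slices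
  \<open>w \<mapsto> \<phi>\<^sup>t(w z)\<close> are holomorphic on a disc containing \<open>1\<close>, bounded uniformly in \<open>t\<close>
  (the flow stays in the polydisc), and tend to \<open>0\<close> uniformly for small \<open>w\<close>. So all their Taylor
  coefficients tend to \<open>0\<close>, and a Vitali argument gives \<open>\<phi>\<^sup>t(z) \<rightarrow> 0\<close>.\<close>

section \<open>Convergence to zero of a bounded holomorphic family\<close>

text \<open>Cauchy's inequality is used on two discs about \<open>z\<close>. On the disc of radius
  \<open>r\<close> it makes each Taylor coefficient tend to 0; on a disc reaching past
  \<open>w\<close> it bounds the Taylor terms at \<open>w\<close> by a geometric series independent
  of \<open>t\<close>. Tannery's theorem then exchanges limit and sum.\<close>

lemma vitali_pointwise_zero:
  fixes f :: "'a \<Rightarrow> complex \<Rightarrow> complex"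
  assumes G: "G \<noteq> bot"
    and hol: "\<forall>\<^sub>F t in G. f t holomorphic_on ball z s"
    and bound: "\<forall>\<^sub>F t in G. \<forall>w\<in>ball z s. cmod (f t w) \<le> M"
    and lim: "uniform_limit (cball z r) f (\<lambda>_. 0) G"
    and r: "0 < r" "r < s" and w: "w \<in> ball z s"
  shows "((\<lambda>t. f t w) \<longlongrightarrow> 0) G"
proof -
  define c where "c k t = (deriv ^^ k) (f t) z / fact k" for k t
  \<comment> \<open>The midpoint between \<open>dist z w\<close> and \<open>s\<close>: estimates on
    the disc of radius \<open>p\<close> give terms of ratio \<open>dist z w / p < 1\<close>.\<close>
  define p where "p = (dist z w + s) / 2"
  have p: "0 < p" "p < s" "dist z w < p"
    using w r by (auto simp: p_def) (smt (verit) zero_le_dist)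
  have cauchy: "cmod (c k t) \<le> B / q ^ k"
    if "f t holomorphic_on ball z s" "0 < q" "q < s" "\<And>x. x \<in> cball z q \<Longrightarrow> cmod (f t x) \<le> B" for k t q B
  proof -
    have "cmod ((deriv ^^ k) (f t) z) \<le> fact k * B / q ^ k"
    proof (rule Cauchy_inequality)
      show "f t holomorphic_on ball z q"
        using that by (auto intro: holomorphic_on_subset)
      have "f t holomorphic_on cball z q"
        using that by (auto intro: holomorphic_on_subset)
      then show "continuous_on (cball z q) (f t)"
        by (rule holomorphic_on_imp_continuous_on)
    qed (use that in \<open>auto simp: dist_norm\<close>)
    then show ?thesis
      by (simp add: c_def norm_divide field_simps)
  qed
  have c_lim: "((\<lambda>t. c k t) \<longlongrightarrow> 0) G" for k
  proof (rule tendstoI)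
    fix e :: real assume "0 < e"
    \<comment> \<open>Cauchy's inequality is not strict, so aiming at \<open>e / 2\<close> yields a
      bound strictly below \<open>e\<close>.\<close>
    then have "\<forall>\<^sub>F t in G. \<forall>x\<in>cball z r. dist (f t x) 0 < e / 2 * r ^ k"
      using r by (intro uniform_limitD[OF lim]) auto
    then show "\<forall>\<^sub>F t in G. dist (c k t) 0 < e"
      using hol
    proof eventually_elim
      case (elim t)
      then have "cmod (c k t) \<le> (e / 2 * r ^ k) / r ^ k"
        using r by (intro cauchy) (auto intro: less_imp_le)
      then show ?case using r \<open>0 < e\<close> by simp
    qed
  qed
  have "((\<lambda>t. \<Sum>k. c k t * (w - z) ^ k) \<longlongrightarrow> (\<Sum>k. 0)) G"
  proof (rule tannerys_theorem[THEN conjunct2, THEN conjunct2])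
    show "((\<lambda>t. c k t * (w - z) ^ k) \<longlongrightarrow> 0) G" for k
      by (rule tendsto_mult_left_zero[OF c_lim])
    have "\<forall>\<^sub>F t in G. \<forall>k. cmod (c k t * (w - z) ^ k) \<le> M * (dist z w / p) ^ k"
      using hol bound
    proof eventually_elim
      case (elim t)
      have "cmod (c k t) \<le> M / p ^ k" for k
        using elim p by (intro cauchy) auto
      then have "cmod (c k t) * cmod (w - z) ^ k \<le> M / p ^ k * cmod (w - z) ^ k" for k
        by (intro mult_right_mono) auto
      then show ?case
        by (simp add: norm_mult norm_power power_divide dist_norm norm_minus_commute)
    qed
    \<comment> \<open>The domination holds for every \<open>k\<close>, so the condition on
      \<open>k\<close> in the product filter is trivial.\<close>
    from eventually_prodI[OF eventually_True[of at_top] this]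
    show "\<forall>\<^sub>F (k, t) in at_top \<times>\<^sub>F G. cmod (c k t * (w - z) ^ k) \<le> M * (dist z w / p) ^ k"
      by (rule eventually_mono) auto
    show "summable (\<lambda>k. M * (dist z w / p) ^ k)"
      using p by (intro summable_mult summable_geometric) auto
  qed (rule G)
  moreover have "\<forall>\<^sub>F t in G. (\<Sum>k. c k t * (w - z) ^ k) = f t w"
    using hol
  proof eventually_elim
    case (elim t)
    then show ?case
      using holomorphic_power_series[OF elim w] by (simp add: c_def sums_iff)
  qed
  ultimately show ?thesis
    by (simp add: filterlim_cong)
qed

section \<open>Exponential decay near the equilibrium\<close>

text \<open>A Gronwall estimate is valid while the orbit stays in the ball of radius \<delta>; a
  first exit time argument shows that the orbit never leaves that ball.\<close>

lemma norm_exponential_decay: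
  fixes x :: "real \<Rightarrow> 'a::real_inner"
  assumes deriv: "\<And>t. t \<ge> 0 \<Longrightarrow> (x has_vector_derivative F (x t)) (at t within {0..})"
    and dissipative: "\<And>y. norm y < \<delta> \<Longrightarrow> F y \<bullet> y \<le> - c * (norm y)\<^sup>2"
    and c: "c \<ge> 0" and start: "norm (x 0) < \<delta>" and "t \<ge> 0"
  shows "norm (x t) \<le> exp (- c * t) * norm (x 0)"
proof -
  have cont: "continuous_on {0..} x"
    using deriv by (intro continuous_on_vector_derivative) auto
  \<comment> \<open>\<open>inside\<close> covers only times strictly before \<open>t\<close>, so
    that the estimate applies at the first exit time itself.\<close>
  have decay: "norm (x t) \<le> exp (- c * t) * norm (x 0)"
    if "t \<ge> 0" and inside: "\<And>s. 0 \<le> s \<Longrightarrow> s < t \<Longrightarrow> norm (x s) < \<delta>" for t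
  proof -
    \<comment> \<open>The weight \<open>exp (2 * c * s)\<close> cancels the decay rate of the
      squared norm, so dissipativity makes \<open>W\<close> nonincreasing.\<close>
    define W where "W s = exp (2 * c * s) * (x s \<bullet> x s)" for s
    have "W t \<le> W 0"
    proof (rule DERIV_nonpos_imp_decreasing_open[OF \<open>t \<ge> 0\<close>])
      show "continuous_on {0..t} W"
        unfolding W_def using continuous_on_subset[OF cont, of "{0..t}"]
        by (intro continuous_intros) auto
      fix s assume s: "0 < s" "s < t"
      \<comment> \<open>At an interior time the derivative within \<open>{0..}\<close> is the
        two-sided one.\<close>
      have "(x has_vector_derivative F (x s)) (at s)"
        using deriv[OF less_imp_le[OF s(1)]] at_within_interior[of s "{0..}"] s(1) by simp
      then have x: "(x has_derivative (\<lambda>h. h *\<^sub>R F (x s))) (at s)"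
        by (simp add: has_vector_derivative_def)
      have "((\<lambda>s. x s \<bullet> x s) has_field_derivative 2 * (F (x s) \<bullet> x s)) (at s)"
        unfolding has_field_derivative_def
        by (rule has_derivative_eq_rhs[OF has_derivative_inner[OF x x]])
          (auto simp: inner_commute)
      then have "(W has_field_derivative
          exp (2 * c * s) * (2 * (F (x s) \<bullet> x s) + 2 * c * (x s \<bullet> x s))) (at s)"
        unfolding W_def by (auto intro!: derivative_eq_intros simp: algebra_simps)
      moreover have "F (x s) \<bullet> x s \<le> - c * (x s \<bullet> x s)"
        using dissipative[OF inside, of s] s by (simp add: power2_norm_eq_inner)
      then have "exp (2 * c * s) * (2 * (F (x s) \<bullet> x s) + 2 * c * (x s \<bullet> x s)) \<le> 0"
        by (intro mult_nonneg_nonpos) auto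
      ultimately show "\<exists>y. DERIV W s :> y \<and> y \<le> 0" by blast
    qed
    then have "(exp (c * t) * norm (x t))\<^sup>2 \<le> (norm (x 0))\<^sup>2"
      by (simp add: W_def power_mult_distrib power2_norm_eq_inner flip: exp_double) (simp add: mult.assoc)
    then have "exp (c * t) * norm (x t) \<le> norm (x 0)"
      by (rule power2_le_imp_le) simp
    then show ?thesis
      by (simp add: exp_minus field_simps)
  qed
  have "norm (x s) < \<delta>" if "s \<ge> 0" for s
  proof (rule ccontr)
    assume "\<not> norm (x s) < \<delta>"
    \<comment> \<open>The least element \<open>u\<close> of this compact set is the first exit time;
      the decay up to \<open>u\<close> gives \<open>norm (x u) \<le> norm (x 0) < \<delta>\<close>,
      a contradiction.\<close>
    define S where "S = {u \<in> {0..s}. \<delta> \<le> norm (x u)}"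
    have "closed S"
      unfolding S_def using continuous_on_subset[OF cont, of "{0..s}"]
      by (intro continuous_on_closed_Collect_le continuous_intros) auto
    then have "compact S"
      by (auto simp: compact_eq_bounded_closed S_def intro: bounded_subset[OF bounded_closed_interval])
    moreover have "s \<in> S"
      using \<open>\<not> norm (x s) < \<delta>\<close> that by (simp add: S_def)
    ultimately obtain u where u: "u \<in> S" "\<And>v. v \<in> S \<Longrightarrow> u \<le> v"
      using compact_attains_inf[of S] by blast
    have "norm (x u) \<le> exp (- c * u) * norm (x 0)"
      using u by (intro decay) (force simp: S_def)+
    also have "\<dots> \<le> 1 * norm (x 0)"
      using c u by (intro mult_right_mono) (auto simp: S_def)
    finally show False
      using u start by (simp add: S_def)
  qed
  then show ?thesis
    using decay \<open>t \<ge> 0\<close> by simp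
qed

section \<open>Diagonal Jacobians and dissipativity\<close>

lemma diagonal_matrix_vector_mult:
  assumes "diagonal_matrix A"
  shows "(A *v y) $ l = A $ l $ l * y $ l"
  using assms by (simp add: matrix_vector_mult_def diagonal_matrix_def sum.remove[of UNIV l])

lemma diagonal_matrix_eigenvalue:
  fixes A :: "complex ^ 'n ^ 'n"
  assumes "diagonal_matrix A"
  shows "eigenvalue A (A $ l $ l)"
  unfolding eigenvalue_def
proof (intro exI conjI)
  show "axis l 1 \<noteq> (0 :: complex ^ 'n)"
    by (simp add: axis_eq_0_iff)
  show "A *v axis l 1 = A $ l $ l *s axis l 1"
    by (simp add: vec_eq_iff diagonal_matrix_vector_mult[OF assms] axis_def)
qed

lemma has_derivative_vec:
  fixes f :: "'a::real_normed_vector \<Rightarrow> 'b::euclidean_space ^ 'n"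
  assumes "\<And>i. ((\<lambda>x. f x $ i) has_derivative (\<lambda>h. f' h $ i)) (at a within S)"
  shows "(f has_derivative f') (at a within S)"
  using assms
  by (subst has_derivative_componentwise_within)
    (auto simp: Basis_vec_def inner_axis intro: has_derivative_inner_left)

text \<open>A Frechet derivative is a priori only real-linear, and \<open>jacobian\<close> records
  just its values on the vectors \<open>axis j 1\<close>. Complex homogeneity lets these values
  determine it everywhere.\<close>

lemma mv_holomorphic_has_jacobian:
  fixes F :: "complex ^ 'n \<Rightarrow> complex ^ 'n"
  assumes "\<And>l. mv_holomorphic_on (\<lambda>z. F z $ l) S" "p \<in> S"
  shows "(F has_derivative (\<lambda>h. jacobian F (at p) *v h)) (at p)"
proof -
  have "\<exists>D. ((\<lambda>z. F z $ l) has_derivative D) (at p) \<and> (\<forall>c v. D (c *s v) = c * D v)" for l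
    using assms unfolding mv_holomorphic_on_def by blast
  then obtain D where D: "\<And>l. ((\<lambda>z. F z $ l) has_derivative D l) (at p)"
    and D_scale: "\<And>l c v. D l (c *s v) = c * D l v"
    by metis
  have F: "(F has_derivative (\<lambda>h. \<chi> l. D l h)) (at p)"
    using D by (intro has_derivative_vec) simp
  have "(\<chi> l. D l h) = jacobian F (at p) *v h" for h
  proof -
    have "D l h = (\<Sum>j\<in>UNIV. D l (axis j 1) * h $ j)" for l
      using linear_sum[OF has_derivative_linear[OF D], of l "\<lambda>j. h $ j *s axis j 1" UNIV]
      by (simp add: basis_expansion D_scale mult.commute)
    moreover have "jacobian F (at p) $ l $ j = D l (axis j 1)" for l j
      by (simp add: jacobian_def matrix_def frechet_derivative_at[OF F, symmetric])
    ultimately show ?thesis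
      by (simp only: vec_eq_iff matrix_vector_mult_def vec_lambda_beta) simp
  qed
  then show ?thesis using F by simp
qed

text \<open>The inner product here is the real part of the Hermitian one, so only the real parts of
  the diagonal entries enter the quadratic form of \<open>A\<close>. The remainder of the
  linearization is small enough to be absorbed.\<close>

lemma diagonal_dissipative_near_equilibrium:
  fixes F :: "complex ^ 'n \<Rightarrow> complex ^ 'n"
  assumes F: "(F has_derivative (\<lambda>h. A *v h)) (at 0)" "F 0 = 0"
    and diag: "diagonal_matrix A" and neg: "\<And>l. Re (A $ l $ l) < 0"
  obtains c \<delta> where "c > 0" "\<delta> > 0"
    "\<And>y. norm y < \<delta> \<Longrightarrow> F y \<bullet> y \<le> - c * (norm y)\<^sup>2"
proof -
  \<comment> \<open>Half the slowest linear rate: the linear part contributes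
    \<open>- (2 * c)\<close>, and the remainder may use up \<open>c\<close> of it.\<close>
  define c where "c = (MIN l. - Re (A $ l $ l)) / 2"
  have "c > 0"
    using neg by (simp add: c_def)
  have c: "2 * c \<le> - Re (A $ l $ l)" for l
    unfolding c_def by (simp add: Min_le)
  have A: "(A *v y) \<bullet> y \<le> - (2 * c) * (norm y)\<^sup>2" for y
  proof -
    have "(A *v y) \<bullet> y = (\<Sum>l\<in>UNIV. Re (A $ l $ l) * (y $ l \<bullet> y $ l))"
      by (simp add: inner_vec_def inner_complex_def diagonal_matrix_vector_mult[OF diag] algebra_simps)
    also have "\<dots> \<le> (\<Sum>l\<in>UNIV. - (2 * c) * (y $ l \<bullet> y $ l))"
      using c by (intro sum_mono mult_right_mono) (auto simp: le_minus_iff minus_le_iff)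
    also have "\<dots> = - (2 * c) * (norm y)\<^sup>2"
      by (simp only: power2_norm_eq_inner inner_vec_def sum_distrib_left)
    finally show ?thesis .
  qed
  obtain \<delta> where \<delta>: "\<delta> > 0" "\<And>y. norm y < \<delta> \<Longrightarrow> norm (F y - A *v y) \<le> c * norm y"
    using F \<open>c > 0\<close> unfolding has_derivative_at_alt by (metis diff_zero)
  show ?thesis
  proof (rule that[OF \<open>c > 0\<close> \<delta>(1)])
    fix y :: "complex ^ 'n" assume y: "norm y < \<delta>"
    have "(F y - A *v y) \<bullet> y \<le> norm (F y - A *v y) * norm y"
      by (rule norm_cauchy_schwarz)
    also have "\<dots> \<le> c * norm y * norm y"
      using \<delta>(2)[OF y] by (rule mult_right_mono) simp
    finally show "F y \<bullet> y \<le> - c * (norm y)\<^sup>2"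
      using A[of y] by (simp add: inner_diff_left power2_eq_square)
  qed
qed

section \<open>Complex lines through the polydisc\<close>

text \<open>By the chain rule the derivative is \<open>h \<mapsto> D (h *s z)\<close>, which complex
  homogeneity turns into multiplication by \<open>D z\<close>.\<close>

lemma mv_holomorphic_slice:
  assumes "mv_holomorphic_on f S" "\<And>w. w \<in> B \<Longrightarrow> w *s z \<in> S"
  shows "(\<lambda>w. f (w *s z)) holomorphic_on B"
proof -
  have "(\<lambda>w. f (w *s z)) field_differentiable (at w within B)" if "w \<in> B" for w
  proof -
    obtain D where D: "(f has_derivative D) (at (w *s z))" "\<And>c v. D (c *s v) = c * D v"
      using assms(1) assms(2)[OF \<open>w \<in> B\<close>] unfolding mv_holomorphic_on_def by (meson subsetD)
    have "((\<lambda>w. w *s z) has_derivative (\<lambda>h. h *s z)) (at w)"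
      by (rule has_derivative_vec)
        (simp add: bounded_linear_imp_has_derivative bounded_linear_mult_left)
    from has_derivative_compose[OF this D(1)]
    have "((\<lambda>w. f (w *s z)) has_field_derivative D z) (at w)"
      by (simp add: D(2) has_field_derivative_def mult_commute_abs)
    then show ?thesis
      using field_differentiable_at_within field_differentiable_def by blast
  qed
  then show ?thesis by (simp add: holomorphic_on_def)
qed

lemma norm_vector_scalar_mult:
  fixes z :: "complex ^ 'n"
  shows "norm (w *s z) = cmod w * norm z"
  by (simp add: norm_vec_def norm_mult L2_set_right_distrib)

text \<open>The largest coordinate modulus \<open>m\<close> is strictly below \<mu>, which leaves
  room to scale by factors of modulus up to \<open>\<mu> / m > 1\<close>.\<close>

lemma polydisc_dilation:
  assumes "z \<in> polydisc \<mu>"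
  obtains s where "s > 1" "\<And>w. w \<in> ball 0 s \<Longrightarrow> w *s z \<in> polydisc \<mu>"
proof -
  define m where "m = (MAX l. cmod (z $ l))"
  have m: "cmod (z $ l) \<le> m" for l
    by (simp add: m_def)
  have "m < \<mu>"
    using assms by (simp add: m_def polydisc_def)
  have "m \<ge> 0"
    using m norm_ge_zero order_trans by blast
  \<comment> \<open>If \<open>m = 0\<close> then \<open>z = 0\<close> and any radius above 1 serves;
    2 is an arbitrary choice.\<close>
  define s where "s = (if m = 0 then 2 else \<mu> / m)"
  show ?thesis
  proof
    show "s > 1"
      using \<open>m < \<mu>\<close> \<open>m \<ge> 0\<close> by (simp add: s_def)
    fix w :: complex assume w: "w \<in> ball 0 s"
    have "cmod w * m < \<mu>"
      using w \<open>m < \<mu>\<close> \<open>m \<ge> 0\<close> by (auto simp: s_def field_simps split: if_splits)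
    moreover have "cmod w * cmod (z $ l) \<le> cmod w * m" for l
      by (rule mult_left_mono[OF m]) simp
    ultimately show "w *s z \<in> polydisc \<mu>"
      by (auto simp: polydisc_def norm_mult intro: le_less_trans)
  qed
qed

section \<open>From local decay to global stability\<close>

lemma GAS_on_polydisc_if_local_decay:
  fixes \<phi> :: "real \<Rightarrow> complex ^ 'n \<Rightarrow> complex ^ 'n"
  assumes hol: "\<And>t l. t \<ge> 0 \<Longrightarrow> mv_holomorphic_on (\<lambda>z. \<phi> t z $ l) (polydisc \<mu>)"
    and maps: "\<And>t z. t \<ge> 0 \<Longrightarrow> z \<in> polydisc \<mu> \<Longrightarrow> \<phi> t z \<in> polydisc \<mu>"
    and "c > 0" "\<delta> > 0"
    and decay: "\<And>t z. t \<ge> 0 \<Longrightarrow> z \<in> polydisc \<mu> \<Longrightarrow> norm z < \<delta> \<Longrightarrow> norm (\<phi> t z) \<le> exp (- c * t) * norm z"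
  shows "GAS_on \<phi> (polydisc \<mu>)"
  unfolding GAS_on_def
proof
  show "lyapunov_stable_on \<phi> (polydisc \<mu>)"
    unfolding lyapunov_stable_on_def
  proof (intro allI impI)
    fix \<epsilon> :: real assume "\<epsilon> > 0"
    have "norm (\<phi> t z) < \<epsilon>" if "z \<in> polydisc \<mu>" "norm z < min \<delta> \<epsilon>" "t \<ge> 0" for t z
    proof -
      have "norm (\<phi> t z) \<le> exp (- c * t) * norm z"
        using that by (intro decay) auto
      also have "\<dots> \<le> 1 * norm z"
        using \<open>c > 0\<close> that by (intro mult_right_mono) auto
      finally show ?thesis using that by simp
    qed
    then show "\<exists>\<delta>>0. \<forall>z\<in>polydisc \<mu>. norm z < \<delta> \<longrightarrow> (\<forall>t\<ge>0. norm (\<phi> t z) < \<epsilon>)"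
      using \<open>\<epsilon> > 0\<close> \<open>\<delta> > 0\<close> by (intro exI[of _ "min \<delta> \<epsilon>"]) auto
  qed
  show "\<forall>z\<in>polydisc \<mu>. ((\<lambda>t. \<phi> t z) \<longlongrightarrow> 0) at_top"
  proof
    fix z :: "complex ^ 'n" assume "z \<in> polydisc \<mu>"
    then obtain s where s: "s > 1" "\<And>w. w \<in> ball 0 s \<Longrightarrow> w *s z \<in> polydisc \<mu>"
      by (rule polydisc_dilation) blast
    \<comment> \<open>The second entry keeps \<open>r * norm z\<close> below \<delta>, with
      \<open>+ 1\<close> guarding against \<open>z = 0\<close>; the first keeps
      \<open>r < 1 < s\<close>.\<close>
    define r where "r = min (1 / 2) (\<delta> / (2 * (norm z + 1)))"
    have r: "0 < r" "r < s"
      using \<open>\<delta> > 0\<close> s by (auto simp: r_def add_nonneg_pos)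
    have small: "norm (w *s z) < \<delta>" if "w \<in> cball 0 r" for w
    proof -
      have "cmod w * norm z \<le> \<delta> / (2 * (norm z + 1)) * norm z"
        using that by (intro mult_right_mono) (auto simp: r_def)
      also have "\<dots> < \<delta>"
      proof -
        have "norm z < 2 * (norm z + 1)"
          using norm_ge_zero[of z] by argo
        then have "\<delta> * norm z < \<delta> * (2 * (norm z + 1))"
          using \<open>\<delta> > 0\<close> by simp
        then show ?thesis
          by (simp add: pos_divide_less_eq add_nonneg_pos)
      qed
      finally show ?thesis
        by (simp add: norm_vector_scalar_mult)
    qed
    have "((\<lambda>t. \<phi> t z $ l) \<longlongrightarrow> 0) at_top" for l
    proof -
      \<comment> \<open>This displays the point \<open>z\<close> as the slice at parameter 1, which
        lies in \<open>ball 0 s\<close> because \<open>s > 1\<close>.\<close>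
      have "((\<lambda>t. \<phi> t (1 *s z) $ l) \<longlongrightarrow> 0) at_top"
      proof (rule vitali_pointwise_zero[where f = "\<lambda>t w. \<phi> t (w *s z) $ l" and z = 0])
        have nonneg: "\<forall>\<^sub>F t in at_top. (t::real) \<ge> 0"
          by (rule eventually_ge_at_top)
        then show "\<forall>\<^sub>F t in at_top. (\<lambda>w. \<phi> t (w *s z) $ l) holomorphic_on ball 0 s"
          by eventually_elim (auto intro: mv_holomorphic_slice[OF hol] s)
        \<comment> \<open>The bound uniform in \<open>t\<close> comes from the flow keeping the
          polydisc of radius \<mu> invariant.\<close>
        from nonneg show "\<forall>\<^sub>F t in at_top. \<forall>w\<in>ball 0 s. cmod (\<phi> t (w *s z) $ l) \<le> \<mu>"
          by eventually_elim (use maps s(2) in \<open>auto simp: polydisc_def intro: less_imp_le\<close>)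
        show "uniform_limit (cball 0 r) (\<lambda>t w. \<phi> t (w *s z) $ l) (\<lambda>_. 0) at_top"
        proof (rule uniform_limitI)
          fix e :: real assume "e > 0"
          \<comment> \<open>This majorant does not depend on \<open>w\<close>, whence the uniformity
            on the small disc.\<close>
          have "((\<lambda>t. exp (- c * t) * \<delta>) \<longlongrightarrow> 0) at_top"
            using \<open>c > 0\<close> by real_asymp
          then have "\<forall>\<^sub>F t in at_top. exp (- c * t) * \<delta> < e"
            using \<open>e > 0\<close> by (rule order_tendstoD)
          then show "\<forall>\<^sub>F t in at_top. \<forall>w\<in>cball 0 r. dist (\<phi> t (w *s z) $ l) 0 < e"
            using nonneg
          proof eventually_elim
            case (elim t)
            show ?case
            proof
              fix w :: complex assume w: "w \<in> cball 0 r"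
              have "cmod (\<phi> t (w *s z) $ l) \<le> norm (\<phi> t (w *s z))"
                by (rule Finite_Cartesian_Product.norm_nth_le)
              also have "\<dots> \<le> exp (- c * t) * norm (w *s z)"
                using w r elim small by (intro decay s) auto
              also have "\<dots> \<le> exp (- c * t) * \<delta>"
                using small[OF w] by (intro mult_left_mono) auto
              also have "\<dots> < e"
                by (rule elim)
              finally show "dist (\<phi> t (w *s z) $ l) 0 < e"
                by simp
            qed
          qed
        qed
      qed (use r s in auto)
      then show ?thesis by simp
    qed
    then show "((\<lambda>t. \<phi> t z) \<longlongrightarrow> 0) at_top"
      by (intro vec_tendstoI) simp
  qed
qed

lemma GAS_on_subset: "GAS_on \<phi> D \<Longrightarrow> E \<subseteq> D \<Longrightarrow> GAS_on \<phi> E"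
  unfolding GAS_on_def lyapunov_stable_on_def by (meson subsetD)

theorem theorem2:
  fixes F :: "complex ^ 'n::{finite,linorder} \<Rightarrow> complex ^ 'n::{finite,linorder}"
    and a :: "'n \<Rightarrow> nat \<Rightarrow> complex"
    and \<phi> :: "real \<Rightarrow> complex ^ 'n::{finite,linorder} \<Rightarrow> complex ^ 'n::{finite,linorder}"
    and \<mu> \<rho> L R :: real
  assumes "\<mu> > 0"
    and series: "\<And>z l. z \<in> polydisc \<mu> \<Longrightarrow>
          (\<lambda>k. a l (Suc k) * mi_monom z (mi_enum (Suc k))) sums (F z $ l)"
    and holomorphic: "\<And>l. mv_holomorphic_on (\<lambda>z. F z $ l) (closed_polydisc \<mu>)"
    and hardy: "\<And>l. (\<lambda>z. F z $ l) \<in> hardy_space \<mu>"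
    and flow: "generates_flow F (polydisc \<mu>) \<phi>"
    and flow_holomorphic: "\<And>t l. t \<ge> 0 \<Longrightarrow> mv_holomorphic_on (\<lambda>z. \<phi> t z $ l) (polydisc \<mu>)"
    and equilibrium: "F 0 = 0" "\<And>z. z \<in> polydisc \<mu> \<Longrightarrow> F z = 0 \<Longrightarrow> z = 0"
    and hyperbolic: "hyperbolic_at F 0"
    and eigenvalues: "\<And>\<nu>. eigenvalue (jacobian F (at 0)) \<nu> \<Longrightarrow> Re \<nu> < 0"
    and diagonal: "diagonal_matrix (jacobian F (at 0))"
    and convergent: "\<And>l. summable (\<lambda>k. \<mu> ^ mi_size (mi_enum (Suc k) :: 'n \<Rightarrow> nat) * cmod (a l (Suc k)))"
    and L: "L = (\<Sum>l\<in>UNIV. \<Sum>k. \<mu> ^ mi_size (mi_enum (Suc k) :: 'n \<Rightarrow> nat) * cmod (a l (Suc k)))"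
    and R: "R = (MIN l\<in>UNIV. \<bar>Re (a l (coord_pos l))\<bar>)"
    and "\<rho> > 0" "\<rho> < \<mu> * R / L"
    and subset: "(polydisc \<rho> :: (complex ^ 'n::{finite,linorder}) set) \<subseteq> polydisc \<mu>"
    and invariant: "forward_invariant \<phi> (polydisc \<rho>)"
  shows "GAS_on \<phi> (polydisc \<rho>)"
proof -
  have "(F has_derivative (\<lambda>h. jacobian F (at 0) *v h)) (at 0)"
    using \<open>\<mu> > 0\<close> by (intro mv_holomorphic_has_jacobian[OF holomorphic]) (simp add: closed_polydisc_def)
  \<comment> \<open>Each diagonal entry is an eigenvalue, so the spectral assumption fixes the sign
    of its real part.\<close>
  moreover have "Re (jacobian F (at 0) $ l $ l) < 0" for l
    by (intro eigenvalues diagonal_matrix_eigenvalue diagonal)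
  ultimately obtain c \<delta> where c: "c > 0" "\<delta> > 0"
    and dissipative: "\<And>y. norm y < \<delta> \<Longrightarrow> F y \<bullet> y \<le> - c * (norm y)\<^sup>2"
    using equilibrium(1) diagonal diagonal_dissipative_near_equilibrium by metis
  \<comment> \<open>Stability is obtained on the polydisc of radius \<mu> and then restricted: both
    halves of \<open>GAS_on\<close> quantify over initial points in the set.\<close>
  have "GAS_on \<phi> (polydisc \<mu>)"
  proof (rule GAS_on_polydisc_if_local_decay[OF flow_holomorphic _ c])
    show "\<phi> t z \<in> polydisc \<mu>" if "t \<ge> 0" "z \<in> polydisc \<mu>" for t z
      using flow that by (simp add: generates_flow_def)
    show "norm (\<phi> t z) \<le> exp (- c * t) * norm z"
      if "t \<ge> 0" "z \<in> polydisc \<mu>" "norm z < \<delta>" for t z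
      using norm_exponential_decay[of "\<lambda>t. \<phi> t z" F \<delta> c t] flow that c dissipative
      by (simp add: generates_flow_def)
  qed
  then show ?thesis
    using subset by (rule GAS_on_subset)
qed

end
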